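(* Let $k$ be a positive integer and $|q|<1$. Then $$\sum_{m\ge 0}DE_k(m)\,q^m=\frac{q^k(q^4;q^4)_\infty}{(q;q)_\infty}\sum_{n\ge 0}\frac{(q;q)_{2n+k-1}\,q^{4n}}{(q^4;q^4)_n}-\frac{(q^4;q^4)_\infty}{(q;q)_\infty}\cdot\frac{q^{2k}(q;q)_\infty}{(1-q)(q^6;q^4)_\infty}\cdot\frac{(-q^{3+2k};q^2)_\infty}{(q^{2k};q^2)_\infty}.$$
   Context: Notation: for complex $\alpha, q$ with $|q|<1$, $(\alpha;q)_0=1$, $(\alpha;q)_n=\prod_{j=0}^{n-1}(1-\alpha q^j)$ for $n\ge 1$, and $(\alpha;q)_\infty=\prod_{j=0}^\infty(1-\alpha q^j)$. For a positive integer $k$, $DE_{k}(n)$ is the number of partitions of $n$ in which the even parts are distinct and the largest part is odd and appears exactly $k$ times; its generating function is $\sum_{n\ge0}DE_{k}(n)q^n=\sum_{n\ge 0}\frac{(-q^2;q^2)_n\,q^{(2n+1)k}}{(q;q^2)_{n}}$. *)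

theory Defs
  imports "HOL-Analysis.Analysis" "HOL-Library.Multiset"
begin

definition qpoch :: "complex \<Rightarrow> complex \<Rightarrow> nat \<Rightarrow> complex" where
  "qpoch a q n = (\<Prod>j<n. 1 - a * q ^ j)"

definition qpoch_inf :: "complex \<Rightarrow> complex \<Rightarrow> complex" where
  "qpoch_inf a q = (\<Prod>j. 1 - a * q ^ j)"

lemma convergent_prod_qpoch_inf:
  fixes a q :: complex
  assumes "norm q < 1"
  shows "convergent_prod (\<lambda>j. 1 - a * q ^ j)"
proof -
  have "summable (\<lambda>j. norm a * norm q ^ j)"
    using assms by (intro summable_mult summable_geometric) simp
  hence "abs_convergent_prod (\<lambda>j. 1 - a * q ^ j)"
    by (simp add: abs_convergent_prod_conv_summable norm_mult norm_power)
  thus ?thesis by (rule abs_convergent_prod_imp_convergent_prod)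
qed

text \<open>A partition of \<open>n\<close> is a finite multiset of positive integers with sum \<open>n\<close>.\<close>

definition partitions :: "nat \<Rightarrow> nat multiset set" where
  "partitions n = {P. 0 \<notin># P \<and> \<Sum>\<^sub># P = n}"

lemma finite_partitions: "finite (partitions n)"
proof (rule finite_subset)
  show "partitions n \<subseteq> mset ` {xs. set xs \<subseteq> {..n} \<and> length xs \<le> n}"
  proof
    fix P assume P: "P \<in> partitions n"
    obtain xs where xs: "P = mset xs" by (metis ex_mset)
    have "length ys \<le> sum_list ys" if "0 \<notin> set ys" for ys :: "nat list"
      using that by (induction ys) auto
    with P xs have "length xs \<le> n"
      by (auto simp: partitions_def sum_mset_sum_list)
    moreover have "set xs \<subseteq> {..n}"
      using P xs member_le_sum_list by (fastforce simp: partitions_def sum_mset_sum_list)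
    ultimately show "P \<in> mset ` {xs. set xs \<subseteq> {..n} \<and> length xs \<le> n}"
      using xs by blast
  qed
qed (simp add: finite_lists_length_le)

text \<open>The empty partition has no largest part, so it is never counted.\<close>

definition DE :: "nat \<Rightarrow> nat \<Rightarrow> nat" where
  "DE k n = card {P \<in> partitions n. P \<noteq> {#} \<and>
     (\<forall>x\<in>#P. even x \<longrightarrow> count P x = 1) \<and>
     odd (Max_mset P) \<and> count P (Max_mset P) = k}"

end

theory Submission
  imports Defs
begin

text \<open>Write \<open>(a; p)\<^sub>n\<close> and \<open>(a; p)\<^sub>\<infinity>\<close> for the \<open>q\<close>-shifted factorials in base \<open>p\<close>. The identity
  comes from evaluating one absolutely convergent double series in two ways, namely the sum over all
  \<open>n\<close> and \<open>m\<close> of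
    \<open>a n m = q^(4 n) / (q^4; q^4)\<^sub>n * q^((2 n + k) m) / (q; q)\<^sub>m\<close>.

  Summed over \<open>m\<close> first, Euler's expansion of \<open>1 / (z; q)\<^sub>\<infinity>\<close> turns it into the series on the
  right-hand side of the theorem, divided by \<open>(q; q)\<^sub>\<infinity>\<close> (\<open>double_sum_rows\<close>). Summed over \<open>n\<close>
  first, the same expansion in base \<open>q^4\<close> leaves a single series over \<open>m\<close> (\<open>double_sum_columns\<close>).
  After multiplication by \<open>q^k (q^4; q^4)\<^sub>\<infinity>\<close>, this single series separates according to the parity
  of \<open>m\<close>. Its terms with even \<open>m\<close> are the terms \<open>q^((2 j + 1) k) (-q^2; q^2)\<^sub>j / (q; q^2)\<^sub>j\<close> of the
  generating function of \<open>DE k\<close> (\<open>even_column\<close>, \<open>has_sum_DE\<close>), and its terms with odd \<open>m\<close> form a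
  \<open>q\<close>-binomial series with the product subtracted in the theorem as its sum (\<open>odd_column\<close>,
  \<open>q_binomial\<close>). Solving for the part with even \<open>m\<close> gives the claim.

  The generating function of \<open>DE k\<close> is obtained by summing \<open>q\<close> to the power of the size over all admissible
  partitions. Splitting off the \<open>k\<close> copies of the largest part \<open>2 n + 1\<close> (\<open>bij_betw_odd_top\<close>) leaves
  the partitions into parts at most \<open>2 n\<close> with distinct even parts, whose generating function arises by
  adjoining one part size after the other (\<open>has_sum_even_distinct\<close>).\<close>

section \<open>Finite and infinite \<open>q\<close>-shifted factorials\<close>

lemma qpoch_0 [simp]: "qpoch a q 0 = 1"
  by (simp add: qpoch_def)

lemma qpoch_Suc: "qpoch a q (Suc n) = qpoch a q n * (1 - a * q ^ n)"
  by (simp add: qpoch_def)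

lemma qpoch_add: "qpoch a q (m + n) = qpoch a q m * qpoch (a * q ^ m) q n"
  by (induction n) (simp_all add: qpoch_Suc power_add mult_ac)

lemma qpoch_zero_left [simp]: "qpoch 0 q n = 1"
  by (simp add: qpoch_def)

lemma qpoch_square: "qpoch (a ^ 2) (q ^ 2) n = qpoch a q n * qpoch (- a) q n"
  by (simp add: qpoch_def flip: prod.distrib)
     (simp add: algebra_simps power2_eq_square power_mult_distrib)

lemma qpoch_double: "qpoch a q (2 * n) = qpoch a (q ^ 2) n * qpoch (a * q) (q ^ 2) n"
  by (induction n) (simp_all add: qpoch_Suc power_mult[symmetric] mult_ac)

lemma qpoch_LIMSEQ:
  assumes "norm q < 1"
  shows "(\<lambda>n. qpoch a q n) \<longlonglongrightarrow> qpoch_inf a q"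
  using convergent_prod_LIMSEQ[OF convergent_prod_qpoch_inf[OF assms, of a]]
  unfolding qpoch_def qpoch_inf_def LIMSEQ_lessThan_iff_atMost by simp

lemma qpoch_inf_zero_left [simp]: "qpoch_inf 0 q = 1"
  by (simp add: qpoch_inf_def)

lemma qpoch_inf_split:
  assumes "norm q < 1"
  shows "qpoch_inf a q = qpoch a q n * qpoch_inf (a * q ^ n) q"
proof (rule LIMSEQ_unique)
  show "(\<lambda>m. qpoch a q (n + m)) \<longlonglongrightarrow> qpoch_inf a q"
    using LIMSEQ_ignore_initial_segment[OF qpoch_LIMSEQ[OF assms], of a n] by (simp add: add.commute)
  show "(\<lambda>m. qpoch a q (n + m)) \<longlonglongrightarrow> qpoch a q n * qpoch_inf (a * q ^ n) q"
    unfolding qpoch_add by (intro tendsto_mult tendsto_const qpoch_LIMSEQ assms)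
qed

lemma one_minus_qpower_neq_0:
  fixes a q :: complex
  assumes "norm q < 1" "norm a < 1"
  shows "1 - a * q ^ n \<noteq> 0"
proof
  assume "1 - a * q ^ n = 0"
  hence "norm a * norm q ^ n = 1" by (metis eq_iff_diff_eq_0 norm_mult norm_one norm_power)
  moreover have "norm a * norm q ^ n \<le> norm a * 1"
    using assms by (intro mult_left_mono power_le_one) auto
  ultimately show False using assms by simp
qed

lemma qpoch_neq_0:
  assumes "norm q < 1" "norm a < 1"
  shows "qpoch a q n \<noteq> 0"
  using one_minus_qpower_neq_0[OF assms] by (simp add: qpoch_def)

lemma qpoch_inf_neq_0:
  assumes "norm q < 1" "norm a < 1"
  shows "qpoch_inf a q \<noteq> 0"
  unfolding qpoch_inf_def
  by (intro prodinf_nonzero convergent_prod_qpoch_inf one_minus_qpower_neq_0 assms)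

lemma norm_power_less_1:
  fixes q :: "'a :: real_normed_div_algebra"
  assumes "norm q < 1" "n > 0"
  shows "norm (q ^ n) < 1"
  using assms by (simp add: norm_power power_less_one_iff)

section \<open>The \<open>q\<close>-binomial theorem\<close>

text \<open>For \<open>|q|, |b| < 1\<close> numerator and denominator converge, the latter to a nonzero limit. The resulting
  uniform bound makes every series below a geometric one as far as convergence is concerned.\<close>

lemma qpoch_quotient_bounded:
  assumes "norm q < 1" "norm b < 1"
  obtains C where "C > 0" "\<And>n. norm (qpoch a q n / qpoch b q n) \<le> C"
proof -
  have "(\<lambda>n. qpoch a q n / qpoch b q n) \<longlonglongrightarrow> qpoch_inf a q / qpoch_inf b q"
    by (intro tendsto_divide qpoch_LIMSEQ qpoch_inf_neq_0 assms)
  hence "Bseq (\<lambda>n. qpoch a q n / qpoch b q n)"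
    by (rule convergent_imp_Bseq[OF convergentI])
  thus ?thesis using that by (auto simp: Bseq_def)
qed

lemma qpoch_quotient_summable:
  assumes "norm q < 1" "norm b < 1" "norm z < 1"
  shows "summable (\<lambda>n. norm (qpoch a q n / qpoch b q n * z ^ n))"
proof -
  obtain C where C: "\<And>n. norm (qpoch a q n / qpoch b q n) \<le> C"
    using qpoch_quotient_bounded[OF assms(1,2)] by blast
  show ?thesis
  proof (rule summable_comparison_test')
    show "summable (\<lambda>n. C * norm z ^ n)"
      using assms by (intro summable_mult summable_geometric) simp
    show "norm (norm (qpoch a q n / qpoch b q n * z ^ n)) \<le> C * norm z ^ n" for n
      unfolding norm_mult norm_power using C[of n] by (simp add: mult_right_mono)
  qed
qed

text \<open>The coefficients satisfy \<open>c (n + 1) (1 - q^(n + 1)) = c n (1 - a q^n)\<close>, so that the sum \<open>\<phi>\<close> satisfies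
  \<open>(1 - z) \<phi> z = (1 - a z) \<phi> (q z)\<close>. Iterating this equation moves the argument to \<open>0\<close>, where the
  power series \<open>\<phi>\<close> is continuous with value \<open>1\<close>, while the factors collected on the way build up the
  two infinite products.\<close>

theorem q_binomial:
  assumes q: "norm q < 1" and z: "norm z < 1"
  shows "((\<lambda>n. qpoch a q n / qpoch q q n * z ^ n) has_sum
           qpoch_inf (a * z) q / qpoch_inf z q) UNIV"
proof -
  define c where "c n = qpoch a q n / qpoch q q n" for n
  define \<phi> where "\<phi> w = (\<Sum>n. c n * w ^ n)" for w
  have nz: "qpoch q q n \<noteq> 0" for n by (intro qpoch_neq_0 q)
  have abs: "summable (\<lambda>n. norm (c n * w ^ n))" if "norm w < 1" for w
    unfolding c_def using qpoch_quotient_summable[OF q q that] .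
  have S: "(\<lambda>n. c n * w ^ n) sums \<phi> w" if "norm w < 1" for w
    unfolding \<phi>_def by (rule summable_sums[OF summable_norm_cancel[OF abs[OF that]]])
  have rec: "c (Suc n) * (1 - q ^ Suc n) = c n * (1 - a * q ^ n)" for n
    using nz[of n] nz[of "Suc n"] by (simp add: c_def qpoch_Suc field_simps)
  have feq: "(1 - w) * \<phi> w = (1 - a * w) * \<phi> (w * q)" if w: "norm w < 1" for w
  proof -
    have wq: "norm (w * q) < 1"
      using w q by (simp add: norm_mult mult_le_one order.strict_trans1[OF mult_right_le_one_le])
    have "(\<lambda>n. c n * w ^ n - c n * (w * q) ^ n) sums (\<phi> w - \<phi> (w * q))"
      by (intro sums_diff S w wq)
    hence "(\<lambda>n. c (Suc n) * w ^ Suc n - c (Suc n) * (w * q) ^ Suc n) sums (\<phi> w - \<phi> (w * q))"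
      by (subst sums_Suc_iff) simp
    also have "(\<lambda>n. c (Suc n) * w ^ Suc n - c (Suc n) * (w * q) ^ Suc n) =
        (\<lambda>n. w * (c n * w ^ n) - a * w * (c n * (w * q) ^ n))"
    proof
      fix n
      have "c (Suc n) * w ^ Suc n - c (Suc n) * (w * q) ^ Suc n
              = (c (Suc n) * (1 - q ^ Suc n)) * w ^ Suc n"
        by (simp add: algebra_simps power_mult_distrib)
      also have "\<dots> = w * (c n * w ^ n) - a * w * (c n * (w * q) ^ n)"
        unfolding rec by (simp add: algebra_simps power_mult_distrib)
      finally show "c (Suc n) * w ^ Suc n - c (Suc n) * (w * q) ^ Suc n =
        w * (c n * w ^ n) - a * w * (c n * (w * q) ^ n)" .
    qed
    finally have "\<phi> w - \<phi> (w * q) = w * \<phi> w - a * w * \<phi> (w * q)"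
      by (rule sums_unique2) (intro sums_diff sums_mult S w wq)
    thus ?thesis by (simp add: algebra_simps)
  qed
  have zq: "norm (z * q ^ n) < 1" for n
  proof -
    have "norm z * norm q ^ n \<le> norm z * 1"
      using q by (intro mult_left_mono power_le_one) auto
    thus ?thesis using z by (simp add: norm_mult norm_power)
  qed
  have iter: "qpoch z q n * \<phi> z = qpoch (a * z) q n * \<phi> (z * q ^ n)" for n
  proof (induction n)
    case (Suc n)
    have "qpoch z q (Suc n) * \<phi> z = (1 - z * q ^ n) * (qpoch z q n * \<phi> z)"
      by (simp add: qpoch_Suc)
    also have "\<dots> = qpoch (a * z) q n * ((1 - z * q ^ n) * \<phi> (z * q ^ n))"
      unfolding Suc by simp
    also have "\<dots> = qpoch (a * z) q (Suc n) * \<phi> (z * q ^ Suc n)"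
      unfolding feq[OF zq] by (simp add: qpoch_Suc mult_ac)
    finally show ?case .
  qed simp
  have "isCont \<phi> 0"
    unfolding \<phi>_def
    by (rule isCont_powser[of _ "1/2"]) (use S[of "1/2"] in \<open>auto simp: sums_iff norm_divide\<close>)
  moreover have "(\<lambda>n. z * q ^ n) \<longlonglongrightarrow> 0"
    by (intro tendsto_mult_right_zero LIMSEQ_power_zero q)
  ultimately have "(\<lambda>n. \<phi> (z * q ^ n)) \<longlonglongrightarrow> \<phi> 0"
    by (rule isCont_tendsto_compose)
  moreover have "\<phi> 0 = 1"
    unfolding \<phi>_def powser_zero by (simp add: c_def)
  ultimately have "(\<lambda>n. qpoch (a * z) q n * \<phi> (z * q ^ n)) \<longlonglongrightarrow> qpoch_inf (a * z) q * 1"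
    by (intro tendsto_mult qpoch_LIMSEQ q) simp
  moreover have "(\<lambda>n. qpoch z q n * \<phi> z) \<longlonglongrightarrow> qpoch_inf z q * \<phi> z"
    by (intro tendsto_mult qpoch_LIMSEQ q tendsto_const)
  ultimately have "qpoch_inf z q * \<phi> z = qpoch_inf (a * z) q"
    unfolding iter by (simp add: LIMSEQ_unique)
  hence "\<phi> z = qpoch_inf (a * z) q / qpoch_inf z q"
    using qpoch_inf_neq_0[OF q z] by (simp add: field_simps)
  thus ?thesis
    using norm_summable_imp_has_sum[OF abs[OF z] S[OF z]] by (simp add: c_def)
qed

corollary euler_qpoch:
  assumes "norm q < 1" "norm z < 1"
  shows "((\<lambda>n. z ^ n / qpoch q q n) has_sum 1 / qpoch_inf z q) UNIV"
  using q_binomial[OF assms, of 0] by simp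

section \<open>Products of absolutely convergent families\<close>

lemma abs_summable_on_Times_mult:
  fixes f :: "'a \<Rightarrow> 'c :: {real_normed_field, banach}" and g :: "'b \<Rightarrow> 'c"
  assumes f: "f abs_summable_on A" and g: "g abs_summable_on B"
  shows "(\<lambda>(x, y). f x * g y) abs_summable_on A \<times> B"
proof (rule summable_on_SigmaI)
  show "((\<lambda>y. norm (case (x, y) of (x, y) \<Rightarrow> f x * g y)) has_sum
          norm (f x) * (\<Sum>\<^sub>\<infinity>y\<in>B. norm (g y))) B" for x
    using has_sum_cmult_right[OF has_sum_infsum[OF g], of "norm (f x)"] by (simp add: norm_mult)
  show "(\<lambda>x. norm (f x) * (\<Sum>\<^sub>\<infinity>y\<in>B. norm (g y))) summable_on A"
    by (intro summable_on_cmult_left f)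
qed auto

lemma has_sum_Times_mult:
  fixes f :: "'a \<Rightarrow> 'c :: {real_normed_field, banach}" and g :: "'b \<Rightarrow> 'c"
  assumes "f abs_summable_on A" "g abs_summable_on B"
    and "(f has_sum S) A" "(g has_sum T) B"
  shows "((\<lambda>(x, y). f x * g y) has_sum S * T) (A \<times> B)"
proof (rule has_sum_SigmaI)
  show "((\<lambda>y. case (x, y) of (x, y) \<Rightarrow> f x * g y) has_sum f x * T) B" for x
    using has_sum_cmult_right[OF assms(4), of "f x"] by simp
  show "((\<lambda>x. f x * T) has_sum S * T) A"
    by (rule has_sum_cmult_left[OF assms(3)])
  show "(\<lambda>(x, y). f x * g y) summable_on A \<times> B"
    by (rule abs_summable_summable[OF abs_summable_on_Times_mult[OF assms(1,2)]])
qed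

section \<open>The generating function of \<open>DE\<close>\<close>

text \<open>A partition counted by \<open>DE k\<close> with largest part \<open>2 n + 1\<close> consists of \<open>k\<close> copies of that part and an
  arbitrary element of \<open>even_distinct n\<close>, the collection of all partitions into smaller parts whose even
  parts are distinct.\<close>

definition even_distinct :: "nat \<Rightarrow> nat multiset set" where
  "even_distinct n = {Q. \<forall>x\<in>#Q. 0 < x \<and> x \<le> 2 * n \<and> (even x \<longrightarrow> count Q x = 1)}"

definition odd_top :: "nat \<Rightarrow> nat multiset set" where
  "odd_top k = {P. 0 \<notin># P \<and> P \<noteq> {#} \<and> (\<forall>x\<in>#P. even x \<longrightarrow> count P x = 1) \<and>
     odd (Max_mset P) \<and> count P (Max_mset P) = k}"

text \<open>Adjoining a new part \<open>v\<close>, with multiplicity restricted to \<open>J\<close>, multiplies the generating function by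
  the sum of \<open>x^(j v)\<close> over \<open>j \<in> J\<close>: the multiplicity of \<open>v\<close> and the remaining parts are chosen
  independently and can both be recovered from the result.\<close>

lemma has_sum_add_part:
  fixes x :: "'a :: {real_normed_field, banach}" and B :: "nat multiset set"
  assumes new: "\<And>Q. Q \<in> B \<Longrightarrow> v \<notin># Q"
    and B: "(\<lambda>Q. x ^ \<Sum>\<^sub># Q) abs_summable_on B" "((\<lambda>Q. x ^ \<Sum>\<^sub># Q) has_sum S) B"
    and J: "(\<lambda>j. x ^ (j * v)) abs_summable_on J" "((\<lambda>j. x ^ (j * v)) has_sum T) J"
  defines "h \<equiv> (\<lambda>(Q, j). Q + replicate_mset j v)"
  shows "(\<lambda>Q. x ^ \<Sum>\<^sub># Q) abs_summable_on h ` (B \<times> J)"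
    and "((\<lambda>Q. x ^ \<Sum>\<^sub># Q) has_sum S * T) (h ` (B \<times> J))"
proof -
  have inj: "inj_on h (B \<times> J)"
  proof (rule inj_onI, clarify)
    fix Q j Q' j' assume *: "Q \<in> B" "Q' \<in> B" "h (Q, j) = h (Q', j')"
    from *(3) have "count (h (Q, j)) v = count (h (Q', j')) v" by (rule arg_cong)
    moreover have "count Q v = 0" "count Q' v = 0" using * new by (auto simp flip: not_in_iff)
    ultimately have "j = j'" by (simp add: h_def)
    with *(3) show "Q = Q' \<and> j = j'" by (simp add: h_def)
  qed
  have weight: "x ^ \<Sum>\<^sub># (h p) = (case p of (Q, j) \<Rightarrow> x ^ \<Sum>\<^sub># Q * x ^ (j * v))" for p
    by (cases p) (simp add: h_def power_add)
  show "(\<lambda>Q. x ^ \<Sum>\<^sub># Q) abs_summable_on h ` (B \<times> J)"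
    unfolding summable_on_reindex[OF inj] o_def weight
    by (rule abs_summable_on_Times_mult[OF B(1) J(1)])
  show "((\<lambda>Q. x ^ \<Sum>\<^sub># Q) has_sum S * T) (h ` (B \<times> J))"
    unfolding has_sum_reindex[OF inj] o_def weight
    by (rule has_sum_Times_mult[OF B(1) J(1) B(2) J(2)])
qed

lemma even_distinct_0: "even_distinct 0 = {{#}}"
proof -
  have "Q = {#}" if "\<forall>x\<in>#Q. 0 < x \<and> x \<le> 0" for Q :: "nat multiset"
    using that by (metis leD multiset_nonemptyE)
  thus ?thesis by (auto simp: even_distinct_def)
qed

text \<open>Raising the bound on the parts by two allows the odd part \<open>2 n + 1\<close> any number of times and the even
  part \<open>2 n + 2\<close> at most once. This becomes the factor \<open>(1 + x^(2 n + 2)) / (1 - x^(2 n + 1))\<close> below.\<close>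

lemma even_distinct_Suc:
  "even_distinct (Suc n) =
     (\<lambda>(Q, e). Q + replicate_mset e (2 * n + 2)) `
       ((\<lambda>(Q, j). Q + replicate_mset j (2 * n + 1)) ` (even_distinct n \<times> UNIV) \<times> {0, 1})"
  (is "?L = ?R")
proof (intro equalityI subsetI)
  fix P assume P: "P \<in> ?L"
  define Q where "Q = filter_mset (\<lambda>x. x \<le> 2 * n) P"
  have out: "count P y = 0" if "y > 2 * n + 2" for y
    using P that by (force simp: even_distinct_def not_in_iff[symmetric])
  have "P = (Q + replicate_mset (count P (2 * n + 1)) (2 * n + 1))
            + replicate_mset (count P (2 * n + 2)) (2 * n + 2)"
  proof (rule multiset_eqI)
    fix y
    consider "y \<le> 2 * n" | "y = 2 * n + 1" | "y = 2 * n + 2" | "y > 2 * n + 2" by linarith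
    thus "count P y = count ((Q + replicate_mset (count P (2 * n + 1)) (2 * n + 1))
            + replicate_mset (count P (2 * n + 2)) (2 * n + 2)) y"
      by cases (auto simp: Q_def out)
  qed
  moreover have "Q \<in> even_distinct n"
    using P by (auto simp: Q_def even_distinct_def)
  moreover have "count P (2 * n + 2) \<in> {0, 1}"
    using P by (cases "2 * n + 2 \<in># P") (auto simp: even_distinct_def not_in_iff)
  ultimately show "P \<in> ?R" by (force simp: image_iff)
next
  fix P assume "P \<in> ?R"
  then obtain Q j e where Q: "Q \<in> even_distinct n" and e: "e \<in> {0, 1}"
    and P: "P = Q + replicate_mset j (2 * n + 1) + replicate_mset e (2 * n + 2)"
    by auto
  have "count Q (2 * n + 2) = 0"
    using Q by (force simp: even_distinct_def not_in_iff[symmetric])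
  with Q e show "P \<in> ?L"
    by (fastforce simp: P even_distinct_def split: if_splits)
qed

text \<open>The statement covers the reals as well as the complex numbers: at the real point \<open>|q|\<close> it provides
  the sum of the norms, from which the absolute convergence in \<open>has_sum_DE\<close> is derived.\<close>

lemma has_sum_even_distinct:
  fixes x :: "'a :: {real_normed_field, banach}"
  assumes x: "norm x < 1"
  shows "(\<lambda>Q. x ^ \<Sum>\<^sub># Q) abs_summable_on even_distinct n \<and>
    ((\<lambda>Q. x ^ \<Sum>\<^sub># Q) has_sum (\<Prod>j<n. (1 + x ^ (2 * j + 2)) / (1 - x ^ (2 * j + 1))))
      (even_distinct n)"
proof (induction n)
  case 0
  have "((\<lambda>Q. x ^ \<Sum>\<^sub># Q) has_sum (\<Sum>Q\<in>{{#}}. x ^ \<Sum>\<^sub># Q)) {{#}}"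
    by (rule has_sum_finite) simp
  thus ?case by (simp add: even_distinct_0)
next
  case (Suc n)
  let ?h1 = "\<lambda>(Q :: nat multiset, j). Q + replicate_mset j (2 * n + 1)"
  let ?B1 = "?h1 ` (even_distinct n \<times> UNIV)"
  have new1: "2 * n + 1 \<notin># Q" if "Q \<in> even_distinct n" for Q
    using that by (force simp: even_distinct_def)
  have new2: "2 * n + 2 \<notin># Q" if "Q \<in> ?B1" for Q
    using that by (force simp: even_distinct_def split: if_splits)
  have r: "norm (x ^ (2 * n + 1)) < 1" by (intro norm_power_less_1 x) simp
  have pow: "x ^ (j * (2 * n + 1)) = (x ^ (2 * n + 1)) ^ j" for j
    by (metis mult.commute power_mult)
  have abs1: "summable (\<lambda>j. norm (x ^ (j * (2 * n + 1))))"
    unfolding pow norm_power[of "x ^ (2 * n + 1)"] using r by (intro summable_geometric) simp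
  have "(\<lambda>j. x ^ (j * (2 * n + 1))) sums (1 / (1 - x ^ (2 * n + 1)))"
    unfolding pow by (rule geometric_sums[OF r])
  note sum1 = norm_summable_imp_has_sum[OF abs1 this]
  have abs1': "(\<lambda>j. x ^ (j * (2 * n + 1))) abs_summable_on UNIV"
    using abs1 by (subst summable_on_UNIV_nonneg_real_iff) auto
  note 1 = has_sum_add_part[OF new1 Suc[THEN conjunct1] Suc[THEN conjunct2] abs1' sum1]
  have sum2: "((\<lambda>j. x ^ (j * (2 * n + 2))) has_sum (1 + x ^ (2 * n + 2))) {0, 1}"
    by (rule has_sum_finiteI) auto
  have "(\<lambda>j. x ^ (j * (2 * n + 2))) abs_summable_on {0, 1}" by simp
  note 2 = has_sum_add_part[OF new2 1 this sum2, folded even_distinct_Suc]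
  show ?case using 2 by (simp add: mult_ac)
qed

lemma sum_mset_power_fibres:
  fixes x :: "'a :: {real_normed_field, banach}" and A :: "nat multiset set"
  assumes "((\<lambda>P. x ^ \<Sum>\<^sub># P) has_sum S) A" and fin: "\<And>m. finite {P \<in> A. \<Sum>\<^sub># P = m}"
  shows "((\<lambda>m. of_nat (card {P \<in> A. \<Sum>\<^sub># P = m}) * x ^ m) has_sum S) UNIV"
proof (rule has_sum_SigmaD)
  have "bij_betw snd (SIGMA m:UNIV. {P \<in> A. \<Sum>\<^sub># P = m}) A"
    by (rule bij_betwI[where g = "\<lambda>P. (\<Sum>\<^sub># P, P)"]) auto
  from has_sum_reindex_bij_betw[OF this, of "\<lambda>P. x ^ \<Sum>\<^sub># P"] assms(1)
  show "((\<lambda>p. x ^ \<Sum>\<^sub># (snd p)) has_sum S) (SIGMA m:UNIV. {P \<in> A. \<Sum>\<^sub># P = m})"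
    by simp
  show "((\<lambda>P. x ^ \<Sum>\<^sub># (snd (m, P))) has_sum of_nat (card {P \<in> A. \<Sum>\<^sub># P = m}) * x ^ m)
          {P \<in> A. \<Sum>\<^sub># P = m}" for m
    by (rule has_sum_finiteI[OF fin]) simp
qed

lemma DE_eq: "DE k m = card {P \<in> odd_top k. \<Sum>\<^sub># P = m}"
  unfolding DE_def partitions_def odd_top_def by (rule arg_cong[of _ _ card]) auto

text \<open>The inverse map removes all copies of the largest part \<open>M\<close>. As \<open>M\<close> is odd, the index \<open>n\<close> with
  \<open>M = 2 n + 1\<close> is \<open>M div 2\<close>.\<close>

lemma bij_betw_odd_top:
  assumes "k > 0"
  shows "bij_betw (\<lambda>(n, Q). Q + replicate_mset k (2 * n + 1)) (SIGMA n:UNIV. even_distinct n) (odd_top k)"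
proof (rule bij_betwI)
  have top: "Max_mset (Q + replicate_mset k (2 * n + 1)) = 2 * n + 1" if "Q \<in> even_distinct n" for n Q
    using that assms by (intro Max_eqI) (auto simp: even_distinct_def split: if_splits)
  have new: "count Q (2 * n + 1) = 0" if "Q \<in> even_distinct n" for n Q
    using that by (force simp: even_distinct_def not_in_iff[symmetric])
  let ?g = "\<lambda>P. (Max_mset P div 2, filter_mset (\<lambda>x. x \<noteq> Max_mset P) P)"
  show "(\<lambda>(n, Q). Q + replicate_mset k (2 * n + 1)) \<in> (SIGMA n:UNIV. even_distinct n) \<rightarrow> odd_top k"
  proof (clarify intro!: Pi_I)
    fix n Q assume Q: "Q \<in> even_distinct n"
    have "count (Q + replicate_mset k (2 * n + 1)) x = 1"
      if "x \<in># Q + replicate_mset k (2 * n + 1)" "even x" for x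
      using that Q by (auto simp: even_distinct_def split: if_splits)
    moreover have "0 \<notin># Q" using Q by (auto simp: even_distinct_def)
    ultimately show "Q + replicate_mset k (2 * n + 1) \<in> odd_top k"
      using assms new[OF Q] unfolding odd_top_def mem_Collect_eq top[OF Q] by auto
  qed
  show "?g \<in> odd_top k \<rightarrow> (SIGMA n:UNIV. even_distinct n)"
  proof (intro Pi_I SigmaI UNIV_I)
    fix P assume P: "P \<in> odd_top k"
    have "x \<le> 2 * (Max_mset P div 2)" if "x \<in># P" "x \<noteq> Max_mset P" for x
    proof -
      have "x \<le> Max_mset P" using that by simp
      moreover have "odd (Max_mset P)" using P by (simp add: odd_top_def)
      ultimately show ?thesis using that(2) by presburger
    qed
    thus "filter_mset (\<lambda>x. x \<noteq> Max_mset P) P \<in> even_distinct (Max_mset P div 2)"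
      using P by (auto simp: even_distinct_def odd_top_def intro: gr0I)
  qed
  show "?g (case p of (n, Q) \<Rightarrow> Q + replicate_mset k (2 * n + 1)) = p"
    if mem: "p \<in> (SIGMA n:UNIV. even_distinct n)" for p
  proof -
    obtain n Q where p: "p = (n, Q)" "Q \<in> even_distinct n" using mem by auto
    have "filter_mset (\<lambda>x. x \<noteq> 2 * n + 1) (Q + replicate_mset k (2 * n + 1)) = Q"
      using new[OF p(2)] by (intro multiset_eqI) auto
    thus ?thesis unfolding p(1) prod.case top[OF p(2)] by simp
  qed
  show "(case ?g P of (n, Q) \<Rightarrow> Q + replicate_mset k (2 * n + 1)) = P" if P: "P \<in> odd_top k" for P
  proof -
    have "2 * (Max_mset P div 2) + 1 = Max_mset P" "count P (Max_mset P) = k"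
      using P by (auto simp: odd_top_def)
    thus ?thesis by (auto intro!: multiset_eqI)
  qed
qed

lemma prod_eq_qpoch_quotient:
  "(\<Prod>j<n. (1 + q ^ (2 * j + 2)) / (1 - q ^ (2 * j + 1))) =
     qpoch (- (q ^ 2)) (q ^ 2) n / qpoch q (q ^ 2) n"
  by (simp add: qpoch_def prod_dividef power_mult[symmetric] power_add[symmetric] add.commute
        flip: power_Suc)

lemma has_sum_DE:
  assumes k: "k > 0" and q: "norm q < 1"
    and S: "((\<lambda>n. q ^ (k * (2 * n + 1)) * (qpoch (- (q ^ 2)) (q ^ 2) n / qpoch q (q ^ 2) n))
              has_sum S) UNIV"
  shows "((\<lambda>m. of_nat (DE k m) * q ^ m) has_sum S) UNIV"
proof -
  define r where "r = norm q"
  have r: "norm r < 1" "0 \<le> r" using q by (simp_all add: r_def)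
  let ?w = "\<lambda>(n, Q). Q + replicate_mset k (2 * n + 1)"
  let ?R = "\<lambda>n. \<Prod>j<n. (1 + r ^ (2 * j + 2)) / (1 - r ^ (2 * j + 1))"
  \<comment> \<open>Summing the norms over each fibre gives the same series at the real point \<open>r\<close>.\<close>
  have abs: "(\<lambda>p. norm (q ^ \<Sum>\<^sub># (?w p))) summable_on (SIGMA n:UNIV. even_distinct n)"
  proof (rule summable_on_SigmaI)
    fix n
    have "((\<lambda>Q. r ^ \<Sum>\<^sub># Q) has_sum ?R n) (even_distinct n)"
      using has_sum_even_distinct[OF r(1)] by blast
    from has_sum_cmult_right[OF this, of "r ^ (k * (2 * n + 1))"]
    show "((\<lambda>Q. norm (q ^ \<Sum>\<^sub># (?w (n, Q)))) has_sum r ^ (k * (2 * n + 1)) * ?R n) (even_distinct n)"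
      by (simp add: norm_power norm_mult r_def power_add mult_ac)
  next
    let ?c = "complex_of_real r"
    have c: "norm ?c < 1" using r by simp
    have "summable (\<lambda>n. norm (?c ^ k) *
        norm (qpoch (- (?c ^ 2)) (?c ^ 2) n / qpoch ?c (?c ^ 2) n * (?c ^ (2 * k)) ^ n))"
      using k c by (intro summable_mult qpoch_quotient_summable norm_power_less_1) auto
    also have "(\<lambda>n. norm (?c ^ k) *
        norm (qpoch (- (?c ^ 2)) (?c ^ 2) n / qpoch ?c (?c ^ 2) n * (?c ^ (2 * k)) ^ n)) =
        (\<lambda>n. norm (complex_of_real (r ^ (k * (2 * n + 1)) * ?R n)))"
    proof
      fix n
      have "complex_of_real (r ^ (k * (2 * n + 1)) * ?R n) =
          ?c ^ k * (qpoch (- (?c ^ 2)) (?c ^ 2) n / qpoch ?c (?c ^ 2) n * (?c ^ (2 * k)) ^ n)"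
        unfolding prod_eq_qpoch_quotient[symmetric]
        by (simp add: power_mult[symmetric] power_add[symmetric] algebra_simps)
      thus "norm (?c ^ k) *
        norm (qpoch (- (?c ^ 2)) (?c ^ 2) n / qpoch ?c (?c ^ 2) n * (?c ^ (2 * k)) ^ n) =
        norm (complex_of_real (r ^ (k * (2 * n + 1)) * ?R n))"
        by (simp only: norm_mult)
    qed
    finally show "(\<lambda>n. r ^ (k * (2 * n + 1)) * ?R n) summable_on UNIV"
      unfolding norm_of_real real_norm_def[symmetric] by (rule norm_summable_imp_summable_on)
  qed simp
  have "((\<lambda>p. q ^ \<Sum>\<^sub># (?w p)) has_sum S) (SIGMA n:UNIV. even_distinct n)"
  proof (rule has_sum_SigmaI[OF _ S abs_summable_summable[OF abs]])
    fix n
    have "((\<lambda>Q. q ^ \<Sum>\<^sub># Q) has_sum qpoch (- (q ^ 2)) (q ^ 2) n / qpoch q (q ^ 2) n) (even_distinct n)"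
      using has_sum_even_distinct[OF q] unfolding prod_eq_qpoch_quotient by blast
    from has_sum_cmult_right[OF this, of "q ^ (k * (2 * n + 1))"]
    show "((\<lambda>Q. q ^ \<Sum>\<^sub># (?w (n, Q))) has_sum
            q ^ (k * (2 * n + 1)) * (qpoch (- (q ^ 2)) (q ^ 2) n / qpoch q (q ^ 2) n)) (even_distinct n)"
      by (simp add: power_add mult_ac)
  qed
  hence "((\<lambda>P. q ^ \<Sum>\<^sub># P) has_sum S) (odd_top k)"
    by (subst (asm) has_sum_reindex_bij_betw[OF bij_betw_odd_top[OF k]])
  moreover have "finite {P \<in> odd_top k. \<Sum>\<^sub># P = m}" for m
    by (rule finite_subset[OF _ finite_partitions[of m]]) (auto simp: odd_top_def partitions_def)
  ultimately show ?thesis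
    unfolding DE_eq by (rule sum_mset_power_fibres)
qed

section \<open>A double series summed by rows and by columns\<close>

lemma has_sum_even_odd:
  fixes h :: "nat \<Rightarrow> 'a :: topological_comm_monoid_add"
  assumes "((\<lambda>j. h (2 * j)) has_sum a) UNIV" "((\<lambda>j. h (2 * j + 1)) has_sum b) UNIV"
  shows "(h has_sum a + b) UNIV"
proof -
  have inj: "inj (\<lambda>j::nat. 2 * j)" "inj (\<lambda>j::nat. 2 * j + 1)" by (auto intro: injI)
  have "(h has_sum a + b) (range (\<lambda>j. 2 * j) \<union> range (\<lambda>j. 2 * j + 1))"
  proof (rule has_sum_Un_disjoint)
    show "(h has_sum a) (range (\<lambda>j. 2 * j))" "(h has_sum b) (range (\<lambda>j. 2 * j + 1))"
      using assms by (simp_all only: has_sum_reindex[OF inj(1)] has_sum_reindex[OF inj(2)] o_def)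
    show "range (\<lambda>j::nat. 2 * j) \<inter> range (\<lambda>j. 2 * j + 1) = {}" by (auto, presburger)
  qed
  moreover have "range (\<lambda>j::nat. 2 * j) \<union> range (\<lambda>j. 2 * j + 1) = UNIV"
    by (metis (no_types, lifting) UNIV_eq_I Un_iff evenE oddE rangeI)
  ultimately show ?thesis by simp
qed

text \<open>The double series that carries the proof. Since \<open>|q^((2 n + k) m)| \<le> |q^(k m)|\<close>, it is dominated by a
  product of two single series, which justifies summing it in either order.\<close>

lemma abs_summable_euler_terms:
  fixes q :: complex
  assumes q: "norm q < 1" and k: "k > 0"
  shows "(\<lambda>p. norm (case p of (n, m) \<Rightarrow>
           q ^ (4 * n) / qpoch (q ^ 4) (q ^ 4) n * (q ^ ((2 * n + k) * m) / qpoch q q m)))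
           summable_on UNIV \<times> UNIV"
proof (rule Infinite_Sum.abs_summable_on_comparison_test)
  have q4: "norm (q ^ 4) < 1" and qk: "norm (q ^ k) < 1"
    using q k by (auto intro!: norm_power_less_1)
  have "summable (\<lambda>n. norm ((q ^ 4) ^ n / qpoch (q ^ 4) (q ^ 4) n))"
    using qpoch_quotient_summable[OF q4 q4 q4, of 0] by simp
  moreover have "summable (\<lambda>m. norm ((q ^ k) ^ m / qpoch q q m))"
    using qpoch_quotient_summable[OF q q qk, of 0] by simp
  ultimately show "(\<lambda>p. norm (case p of (n, m) \<Rightarrow>
      (q ^ 4) ^ n / qpoch (q ^ 4) (q ^ 4) n * ((q ^ k) ^ m / qpoch q q m)))
      summable_on UNIV \<times> UNIV"
    by (intro abs_summable_on_Times_mult) (simp_all add: summable_on_UNIV_nonneg_real_iff)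
  fix p :: "nat \<times> nat"
  obtain n m where p: "p = (n, m)" by (cases p)
  have "norm (q ^ ((2 * n + k) * m)) \<le> norm ((q ^ k) ^ m)"
    unfolding norm_power power_mult[symmetric] using q by (intro power_decreasing) auto
  thus "norm (case p of (n, m) \<Rightarrow>
          q ^ (4 * n) / qpoch (q ^ 4) (q ^ 4) n * (q ^ ((2 * n + k) * m) / qpoch q q m))
      \<le> norm (case p of (n, m) \<Rightarrow>
          (q ^ 4) ^ n / qpoch (q ^ 4) (q ^ 4) n * ((q ^ k) ^ m / qpoch q q m))"
    unfolding p prod.case norm_mult norm_divide power_mult[symmetric]
    by (intro mult_left_mono divide_right_mono) auto
qed

text \<open>By Euler's formula the sum over \<open>m\<close> contributes \<open>1 / (q^(2 n + k); q)\<^sub>\<infinity>\<close>, and this equals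
  \<open>(q; q)\<close> with index \<open>2 n + k - 1\<close> divided by \<open>(q; q)\<^sub>\<infinity>\<close>, because \<open>k > 0\<close>. Hence the rows
  give the series on the right-hand side of the theorem.\<close>

lemma double_sum_rows:
  fixes q :: complex
  assumes q: "norm q < 1" and k: "k > 0"
  shows "((\<lambda>m. q ^ (4 * n) / qpoch (q ^ 4) (q ^ 4) n * (q ^ ((2 * n + k) * m) / qpoch q q m)) has_sum
    qpoch q q (2 * n + k - 1) * q ^ (4 * n) / qpoch (q ^ 4) (q ^ 4) n / qpoch_inf q q) UNIV"
proof -
  have z: "norm (q ^ (2 * n + k)) < 1" using k by (intro norm_power_less_1 q) simp
  have "q * q ^ (2 * n + k - 1) = q ^ (2 * n + k)"
    using k by (simp flip: power_Suc)
  hence "qpoch_inf q q = qpoch q q (2 * n + k - 1) * qpoch_inf (q ^ (2 * n + k)) q"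
    using qpoch_inf_split[OF q, of q "2 * n + k - 1"] by simp
  hence "1 / qpoch_inf (q ^ (2 * n + k)) q = qpoch q q (2 * n + k - 1) / qpoch_inf q q"
    using qpoch_inf_neq_0[OF q q] by (simp add: field_simps)
  with euler_qpoch[OF q z]
  have "((\<lambda>m. q ^ ((2 * n + k) * m) / qpoch q q m) has_sum
           qpoch q q (2 * n + k - 1) / qpoch_inf q q) UNIV"
    by (simp add: power_mult)
  from has_sum_cmult_right[OF this, of "q ^ (4 * n) / qpoch (q ^ 4) (q ^ 4) n"]
  show ?thesis by (simp add: mult_ac)
qed

text \<open>Here the dependence on \<open>n\<close> is \<open>q^((4 + 2 m) n) / (q^4; q^4)\<^sub>n\<close>, so that Euler's formula in base
  \<open>q^4\<close> applies.\<close>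

lemma double_sum_columns:
  fixes q :: complex
  assumes q: "norm q < 1"
  shows "((\<lambda>n. q ^ (4 * n) / qpoch (q ^ 4) (q ^ 4) n * (q ^ ((2 * n + k) * m) / qpoch q q m)) has_sum
    q ^ (k * m) / (qpoch q q m * qpoch_inf (q ^ (4 + 2 * m)) (q ^ 4))) UNIV"
proof -
  have q4: "norm (q ^ 4) < 1" and z: "norm (q ^ (4 + 2 * m)) < 1"
    by (auto intro!: norm_power_less_1 q)
  have eq: "q ^ (k * m) / qpoch q q m * ((q ^ (4 + 2 * m)) ^ n / qpoch (q ^ 4) (q ^ 4) n) =
      q ^ (4 * n) / qpoch (q ^ 4) (q ^ 4) n * (q ^ ((2 * n + k) * m) / qpoch q q m)" for n
    by (simp add: power_mult[symmetric] power_add[symmetric] algebra_simps)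
  show ?thesis
    using has_sum_cmult_right[OF euler_qpoch[OF q4 z], of "q ^ (k * m) / qpoch q q m"]
    unfolding eq by simp
qed

text \<open>For \<open>m = 2 j\<close> the infinite products leave the finite factor \<open>(q^4; q^4)\<^sub>j\<close>, which splits as
  \<open>(q^2; q^2)\<^sub>j (-q^2; q^2)\<^sub>j\<close>. The first of these cancels the factors \<open>1 - q^i\<close> of \<open>(q; q)\<^sub>m\<close> with even \<open>i\<close>,
  and the quotient is the one in the generating function of \<open>DE\<close>.\<close>

lemma even_column:
  fixes q :: complex
  assumes q: "norm q < 1"
  shows "qpoch_inf (q ^ 4) (q ^ 4) / (qpoch q q (2 * j) * qpoch_inf (q ^ (4 + 4 * j)) (q ^ 4)) =
    qpoch (- (q ^ 2)) (q ^ 2) j / qpoch q (q ^ 2) j"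
proof -
  have q2: "norm (q ^ 2) < 1" and q4: "norm (q ^ 4) < 1" and z: "norm (q ^ (4 + 4 * j)) < 1"
    by (auto intro!: norm_power_less_1 q)
  have "qpoch_inf (q ^ 4) (q ^ 4) = qpoch (q ^ 4) (q ^ 4) j * qpoch_inf (q ^ (4 + 4 * j)) (q ^ 4)"
    using qpoch_inf_split[OF q4, of "q ^ 4" j] by (simp only: power_add power_mult)
  moreover have "qpoch (q ^ 4) (q ^ 4) j = qpoch (q ^ 2) (q ^ 2) j * qpoch (- (q ^ 2)) (q ^ 2) j"
    using qpoch_square[of "q ^ 2" "q ^ 2" j] by (simp flip: power_mult)
  moreover have "qpoch q q (2 * j) = qpoch q (q ^ 2) j * qpoch (q ^ 2) (q ^ 2) j"
    using qpoch_double[of q q j] by (simp flip: power2_eq_square)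
  ultimately show ?thesis
    using qpoch_neq_0[OF q2 q2, of j] qpoch_neq_0[OF q2 q, of j] qpoch_inf_neq_0[OF q4 z]
    by simp
qed

text \<open>For \<open>m = 2 j + 1\<close> the argument of the infinite product is shifted to \<open>q^6\<close>, and
  \<open>(q^6; q^4)\<^sub>j = (q^3; q^2)\<^sub>j (-q^3; q^2)\<^sub>j\<close>. What remains is a coefficient of the \<open>q\<close>-binomial
  series in base \<open>q^2\<close> with \<open>a = -q^3\<close>.\<close>

lemma odd_column:
  fixes q :: complex
  assumes q: "norm q < 1"
  shows "1 / (qpoch q q (2 * j + 1) * qpoch_inf (q ^ (6 + 4 * j)) (q ^ 4)) =
    qpoch (- (q ^ 3)) (q ^ 2) j / qpoch (q ^ 2) (q ^ 2) j / ((1 - q) * qpoch_inf (q ^ 6) (q ^ 4))"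
proof -
  have q2: "norm (q ^ 2) < 1" and q3: "norm (q ^ 3) < 1" and q4: "norm (q ^ 4) < 1"
    and z: "norm (q ^ (6 + 4 * j)) < 1"
    by (auto intro!: norm_power_less_1 q)
  have "qpoch_inf (q ^ 6) (q ^ 4) = qpoch (q ^ 6) (q ^ 4) j * qpoch_inf (q ^ (6 + 4 * j)) (q ^ 4)"
    using qpoch_inf_split[OF q4, of "q ^ 6" j] by (simp only: power_add power_mult)
  moreover have "qpoch (q ^ 6) (q ^ 4) j = qpoch (q ^ 3) (q ^ 2) j * qpoch (- (q ^ 3)) (q ^ 2) j"
    using qpoch_square[of "q ^ 3" "q ^ 2" j] by (simp flip: power_mult)
  moreover have "qpoch q q (2 * j + 1) = (1 - q) * (qpoch (q ^ 2) (q ^ 2) j * qpoch (q ^ 3) (q ^ 2) j)"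
    using qpoch_add[of q q 1 "2 * j"] qpoch_double[of "q ^ 2" q j]
    by (simp add: qpoch_Suc[of _ _ 0, simplified] add.commute power3_eq_cube power2_eq_square mult_ac)
  moreover have "1 - q \<noteq> 0" using q by auto
  moreover have "qpoch (- (q ^ 3)) (q ^ 2) j \<noteq> 0"
    by (rule qpoch_neq_0) (use q2 q3 in auto)
  ultimately show ?thesis
    using qpoch_neq_0[OF q2 q2, of j] qpoch_neq_0[OF q2 q3, of j] qpoch_inf_neq_0[OF q4 z]
    by simp
qed

theorem theorem2:
  fixes k :: nat and q :: complex
  assumes "k > 0" and "norm q < 1"
  shows "summable (\<lambda>m. of_nat (DE k m) * q ^ m) \<and>
    summable (\<lambda>n. qpoch q q (2 * n + k - 1) * q ^ (4 * n) / qpoch (q ^ 4) (q ^ 4) n) \<and>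
    (\<Sum>m. of_nat (DE k m) * q ^ m) =
      q ^ k * qpoch_inf (q ^ 4) (q ^ 4) / qpoch_inf q q
        * (\<Sum>n. qpoch q q (2 * n + k - 1) * q ^ (4 * n) / qpoch (q ^ 4) (q ^ 4) n)
      - qpoch_inf (q ^ 4) (q ^ 4) / qpoch_inf q q
        * (q ^ (2 * k) * qpoch_inf q q / ((1 - q) * qpoch_inf (q ^ 6) (q ^ 4)))
        * (qpoch_inf (- (q ^ (3 + 2 * k))) (q ^ 2) / qpoch_inf (q ^ (2 * k)) (q ^ 2))"
proof -
  note k = assms(1) and q = assms(2)
  have q2: "norm (q ^ 2) < 1" and q2k: "norm (q ^ (2 * k)) < 1"
    using k by (auto intro!: norm_power_less_1 q)
  define E P where "E = qpoch_inf (q ^ 4) (q ^ 4)" and "P = qpoch_inf q q"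
  have P: "P \<noteq> 0" unfolding P_def by (rule qpoch_inf_neq_0[OF q q])
  define t where "t n = qpoch q q (2 * n + k - 1) * q ^ (4 * n) / qpoch (q ^ 4) (q ^ 4) n" for n
  define a where "a n m =
    q ^ (4 * n) / qpoch (q ^ 4) (q ^ 4) n * (q ^ ((2 * n + k) * m) / qpoch q q m)" for n m
  define h where "h m = q ^ (k * m) / (qpoch q q m * qpoch_inf (q ^ (4 + 2 * m)) (q ^ 4))" for m

  define T where "T = (\<Sum>\<^sub>\<infinity>(n, m)\<in>UNIV \<times> UNIV. a n m)"
  have T: "((\<lambda>(n, m). a n m) has_sum T) (UNIV \<times> UNIV)"
    unfolding T_def a_def
    by (rule has_sum_infsum[OF abs_summable_summable[OF abs_summable_euler_terms[OF q k]]])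
  have "((\<lambda>n. t n / P) has_sum T) UNIV"
    by (rule has_sum_SigmaD[OF T]) (simp only: prod.case a_def t_def P_def double_sum_rows[OF q k])
  from has_sum_cmult_right[OF this, of P] have t: "(t has_sum P * T) UNIV"
    using P by simp
  have "((\<lambda>(m, n). a n m) has_sum T) (UNIV \<times> UNIV)"
    using T by (subst (asm) has_sum_swap) simp
  hence hT: "(h has_sum T) UNIV"
    by (rule has_sum_SigmaD) (simp only: prod.case a_def h_def double_sum_columns[OF q])

  \<comment> \<open>The generating function of \<open>DE k\<close>, summed over the size \<open>2 n + 1\<close> of the largest part.\<close>
  define b where "b n = q ^ (k * (2 * n + 1)) * (qpoch (- (q ^ 2)) (q ^ 2) n / qpoch q (q ^ 2) n)" for n
  define S where "S = (\<Sum>\<^sub>\<infinity>n. b n)"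
  have "summable (\<lambda>n. norm (q ^ k) *
      norm (qpoch (- (q ^ 2)) (q ^ 2) n / qpoch q (q ^ 2) n * (q ^ (2 * k)) ^ n))"
    by (intro summable_mult qpoch_quotient_summable q q2 q2k)
  moreover have "b n =
      q ^ k * (qpoch (- (q ^ 2)) (q ^ 2) n / qpoch q (q ^ 2) n * (q ^ (2 * k)) ^ n)" for n
    by (simp add: b_def power_mult[symmetric] power_add[symmetric] algebra_simps)
  ultimately have "summable (\<lambda>n. norm (b n))"
    by (simp only: norm_mult)
  hence S: "(b has_sum S) UNIV"
    unfolding S_def by (intro has_sum_infsum norm_summable_imp_summable_on)
  have DE: "((\<lambda>m. of_nat (DE k m) * q ^ m) has_sum S) UNIV"
    by (rule has_sum_DE[OF k q S[unfolded b_def]])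

  \<comment> \<open>Splitting the column sums by parity: the even columns give \<open>S\<close>, the odd ones the product term.\<close>
  have "q ^ k * E * h (2 * j) = b j" for j
  proof -
    have "E * h (2 * j) = q ^ (k * (2 * j)) *
        (E / (qpoch q q (2 * j) * qpoch_inf (q ^ (4 + 4 * j)) (q ^ 4)))"
      by (simp add: h_def)
    also have "\<dots> = q ^ (k * (2 * j)) * (qpoch (- (q ^ 2)) (q ^ 2) j / qpoch q (q ^ 2) j)"
      unfolding E_def even_column[OF q] ..
    finally show ?thesis by (simp add: b_def power_add mult.assoc)
  qed
  moreover define V where "V = qpoch_inf (- (q ^ (3 + 2 * k))) (q ^ 2) / qpoch_inf (q ^ (2 * k)) (q ^ 2)"
  define D where "D = (1 - q) * qpoch_inf (q ^ 6) (q ^ 4)"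
  have "q ^ k * E * h (2 * j + 1) = E * q ^ (2 * k) / D *
      (qpoch (- (q ^ 3)) (q ^ 2) j / qpoch (q ^ 2) (q ^ 2) j * (q ^ (2 * k)) ^ j)" for j
  proof -
    have "h (2 * j + 1) = q ^ (k * (2 * j + 1)) *
        (1 / (qpoch q q (2 * j + 1) * qpoch_inf (q ^ (6 + 4 * j)) (q ^ 4)))"
      by (simp add: h_def)
    also have "\<dots> = q ^ (k * (2 * j + 1)) *
        (qpoch (- (q ^ 3)) (q ^ 2) j / qpoch (q ^ 2) (q ^ 2) j / D)"
      unfolding odd_column[OF q] D_def ..
    moreover have "q ^ k * q ^ (k * (2 * j + 1)) = q ^ (2 * k) * (q ^ (2 * k)) ^ j"
      by (simp add: power_mult[symmetric] power_add[symmetric] algebra_simps)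
    ultimately show ?thesis by (simp add: mult_ac)
  qed
  moreover have "((\<lambda>j. E * q ^ (2 * k) / D *
      (qpoch (- (q ^ 3)) (q ^ 2) j / qpoch (q ^ 2) (q ^ 2) j * (q ^ (2 * k)) ^ j))
      has_sum E * q ^ (2 * k) / D * V) UNIV"
    using has_sum_cmult_right[OF q_binomial[OF q2 q2k, of "- (q ^ 3)"], of "E * q ^ (2 * k) / D"]
    by (simp add: V_def power_add)
  ultimately have "((\<lambda>m. q ^ k * E * h m) has_sum S + E * q ^ (2 * k) / D * V) UNIV"
    using S by (intro has_sum_even_odd) simp_all
  with has_sum_cmult_right[OF hT, of "q ^ k * E"]
  have key: "q ^ k * E * T = S + E * q ^ (2 * k) / D * V"
    by (rule has_sum_unique)

  have "S = q ^ k * E * T - E * q ^ (2 * k) / D * V"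
    unfolding key by (rule add_diff_cancel_right'[symmetric])
  also have "\<dots> = q ^ k * E / P * (P * T) - E / P * (q ^ (2 * k) * P / D) * V"
    using P by simp
  finally have "S = q ^ k * E / P * (P * T) - E / P * (q ^ (2 * k) * P / D) * V" .
  moreover have "(\<lambda>m. of_nat (DE k m) * q ^ m) sums S" "t sums (P * T)"
    by (rule has_sum_imp_sums[OF DE], rule has_sum_imp_sums[OF t])
  ultimately show ?thesis
    unfolding t_def E_def P_def D_def V_def by (simp add: sums_iff)
qed

end
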